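(* Let $\mathcal{X}$ and $\mathcal{A}$ be finite sets, $K$ a positive integer, $x_1\in\mathcal{X}$ given, $\{\xi_k\}_{k=1}^{K-1}$ an i.i.d. random sequence, $h$ a state-transition function with $h(x,a,\xi)\in\mathcal{X}$, and $\tilde g:\mathcal{X}^*\times\mathcal{A}^*\to\mathbb{R}_+$ a function, where $\mathcal{X}^*=\mathcal{X}\cup\mathcal{X}^2\cup\cdots$ and $\mathcal{A}^*=\mathcal{A}\cup\mathcal{A}^2\cup\cdots$. Consider the stochastic control problem of maximizing $\mathrm{E}[\tilde g(x_1,\dots,x_K;\pi_1(x_1),\dots,\pi_K(x_K))\mid x_1]$ over policies $(\pi_1,\dots,\pi_K)$ subject to $x_{k+1}=h(x_k,\pi_k(x_k),\xi_k)$, $k=1,\dots,K-1$. Then any path-dependent action optimization (PDAO) scheme for this problem is also a greedy policy-selection (GPS) scheme: given a PDAO policy $\Pi_K^p=(\pi_1^p,\dots,\pi_K^p)$, there exists a GPS policy $\Pi_K^g=(\pi_1^g,\dots,\pi_K^g)$ such that $\pi_j^p=\pi_j^g$ for all $1\le j\le K$.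
   Context: Policy: a policy $\pi_k$ at time $k$ is a (randomized) mapping assigning to each state in $\mathcal{X}$ an action in $\mathcal{A}$, where the chosen action is a random variable measurable with respect to $\xi_1,\dots,\xi_{k-1}$ (so $\pi_k$ may be viewed as a random map $\mathcal{X}\to\mathcal{A}$ determined by $\xi_1,\dots,\xi_{k-1}$). A string $(\pi_1,\dots,\pi_K)$ is also called a policy. $\mathrm{E}[\cdot\mid x_1]$ is expectation given the initial state $x_1$. PDAO scheme: given $x_1^p=x_1$, the policy $(\pi_1^p,\dots,\pi_K^p)$ is a PDAO scheme if for every $k=1,\dots,K$ (along every sample path $\xi_1,\dots,\xi_{k-1}$) $$\pi_k^p(x_k^p)\in\operatorname*{argmax}_{a\in\mathcal{A}}\ \tilde g(x_1^p,\dots,x_k^p;\pi_1^p(x_1^p),\dots,\pi_{k-1}^p(x_{k-1}^p),a),$$ where $x_{i+1}^p=h(x_i^p,\pi_i^p(x_i^p),\xi_i)$ for $1\le i\le k-1$. GPS scheme: given $x_1^g=x_1$, the policy $(\pi_1^g,\dots,\pi_K^g)$ is a GPS scheme if for every $k=1,\dots,K$ $$\pi_k^g\in\operatorname*{argmax}_{\pi_k}\ \mathrm{E}[\tilde g(x_1^g,\dots,x_k^g;\pi_1^g(x_1^g),\dots,\pi_{k-1}^g(x_{k-1}^g),\pi_k(x_k^g))\mid x_1],$$ the argmax being over all policies $\pi_k$ at time $k$, where $x_{i+1}^g=h(x_i^g,\pi_i^g(x_i^g),\xi_i)$ for $1\le i\le k-1$. *)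

theory Defs
  imports "HOL-Probability.Probability"
begin

text \<open>
  Times start at 1. A policy string is a function
  \<open>\<pi> :: nat \<Rightarrow> 'w \<Rightarrow> 'x \<Rightarrow> 'a\<close>: the action prescribed at time \<open>k\<close> in state \<open>x\<close>
  on the outcome \<open>\<omega>\<close> is \<open>\<pi> k \<omega> x\<close>. Only the entries \<open>1, \<dots>, K\<close> matter.
\<close>

text \<open>
  The sigma-algebra generated by \<open>\<xi> 1, \<dots>, \<xi> (k - 1)\<close>; it is trivial for \<open>k = 1\<close>.
\<close>

definition noise_history ::
    "'w measure \<Rightarrow> 's measure \<Rightarrow> (nat \<Rightarrow> 'w \<Rightarrow> 's) \<Rightarrow> nat \<Rightarrow> 'w measure" where
  "noise_history M S \<xi> k =
     vimage_algebra (space M) (\<lambda>\<omega>. \<lambda>i\<in>{1..<k}. \<xi> i \<omega>) (PiM {1..<k} (\<lambda>_. S))"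

text \<open>Measurability into \<open>count_space A\<close> includes that the chosen actions lie in \<open>A\<close>.\<close>

definition policy_at ::
    "'w measure \<Rightarrow> 's measure \<Rightarrow> (nat \<Rightarrow> 'w \<Rightarrow> 's) \<Rightarrow> 'x set \<Rightarrow> 'a set \<Rightarrow> nat
     \<Rightarrow> ('w \<Rightarrow> 'x \<Rightarrow> 'a) \<Rightarrow> bool" where
  "policy_at M S \<xi> X A k p \<longleftrightarrow>
     (\<forall>x\<in>X. (\<lambda>\<omega>. p \<omega> x) \<in> noise_history M S \<xi> k \<rightarrow>\<^sub>M count_space A)"

text \<open>The value at time 0 is a dummy.\<close>

fun state ::
    "('x \<Rightarrow> 'a \<Rightarrow> 's \<Rightarrow> 'x) \<Rightarrow> (nat \<Rightarrow> 'w \<Rightarrow> 's) \<Rightarrow> 'x \<Rightarrow> (nat \<Rightarrow> 'w \<Rightarrow> 'x \<Rightarrow> 'a)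
     \<Rightarrow> nat \<Rightarrow> 'w \<Rightarrow> 'x" where
  "state h \<xi> x1 \<pi> 0 \<omega> = x1"
| "state h \<xi> x1 \<pi> (Suc 0) \<omega> = x1"
| "state h \<xi> x1 \<pi> (Suc (Suc k)) \<omega> =
     h (state h \<xi> x1 \<pi> (Suc k) \<omega>)
       (\<pi> (Suc k) \<omega> (state h \<xi> x1 \<pi> (Suc k) \<omega>))
       (\<xi> (Suc k) \<omega>)"

text \<open>
  The value of \<open>g\<close> on the states \<open>x\<^sub>1, \<dots>, x\<^sub>k\<close> generated by \<open>\<pi>\<close> up to time \<open>k\<close> and
  on the actions of \<open>\<pi>\<close> at times \<open>1, \<dots>, k - 1\<close> followed by the action \<open>a\<close> at time \<open>k\<close>.
\<close>

definition path_reward ::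
    "('x list \<Rightarrow> 'a list \<Rightarrow> real) \<Rightarrow> ('x \<Rightarrow> 'a \<Rightarrow> 's \<Rightarrow> 'x) \<Rightarrow> (nat \<Rightarrow> 'w \<Rightarrow> 's) \<Rightarrow> 'x
     \<Rightarrow> (nat \<Rightarrow> 'w \<Rightarrow> 'x \<Rightarrow> 'a) \<Rightarrow> nat \<Rightarrow> 'w \<Rightarrow> 'a \<Rightarrow> real" where
  "path_reward g h \<xi> x1 \<pi> k \<omega> a =
     g (map (\<lambda>i. state h \<xi> x1 \<pi> i \<omega>) [1..<Suc k])
       (map (\<lambda>i. \<pi> i \<omega> (state h \<xi> x1 \<pi> i \<omega>)) [1..<k] @ [a])"

definition pdao_scheme ::
    "'w measure \<Rightarrow> 's measure \<Rightarrow> (nat \<Rightarrow> 'w \<Rightarrow> 's) \<Rightarrow> 'x set \<Rightarrow> 'a set \<Rightarrow> nat \<Rightarrow> 'x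
     \<Rightarrow> ('x \<Rightarrow> 'a \<Rightarrow> 's \<Rightarrow> 'x) \<Rightarrow> ('x list \<Rightarrow> 'a list \<Rightarrow> real)
     \<Rightarrow> (nat \<Rightarrow> 'w \<Rightarrow> 'x \<Rightarrow> 'a) \<Rightarrow> bool" where
  "pdao_scheme M S \<xi> X A K x1 h g \<pi> \<longleftrightarrow>
     (\<forall>k\<in>{1..K}. policy_at M S \<xi> X A k (\<pi> k)) \<and>
     (\<forall>k\<in>{1..K}. \<forall>\<omega>\<in>space M.
        is_arg_max (path_reward g h \<xi> x1 \<pi> k \<omega>) (\<lambda>a. a \<in> A)
          (\<pi> k \<omega> (state h \<xi> x1 \<pi> k \<omega>)))"

text \<open>
  The initial state is deterministic, so the conditional expectation given it is the
  plain expectation. The state at time \<open>k\<close> depends only on \<open>\<pi> 1, \<dots>, \<pi> (k - 1)\<close>;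
  hence only the last action varies with the competing policy \<open>p\<close>.
\<close>

definition gps_scheme ::
    "'w measure \<Rightarrow> 's measure \<Rightarrow> (nat \<Rightarrow> 'w \<Rightarrow> 's) \<Rightarrow> 'x set \<Rightarrow> 'a set \<Rightarrow> nat \<Rightarrow> 'x
     \<Rightarrow> ('x \<Rightarrow> 'a \<Rightarrow> 's \<Rightarrow> 'x) \<Rightarrow> ('x list \<Rightarrow> 'a list \<Rightarrow> real)
     \<Rightarrow> (nat \<Rightarrow> 'w \<Rightarrow> 'x \<Rightarrow> 'a) \<Rightarrow> bool" where
  "gps_scheme M S \<xi> X A K x1 h g \<pi> \<longleftrightarrow>
     (\<forall>k\<in>{1..K}. policy_at M S \<xi> X A k (\<pi> k)) \<and>
     (\<forall>k\<in>{1..K}.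
        is_arg_max
          (\<lambda>p. \<integral>\<omega>. path_reward g h \<xi> x1 \<pi> k \<omega> (p \<omega> (state h \<xi> x1 \<pi> k \<omega>)) \<partial>M)
          (policy_at M S \<xi> X A k) (\<pi> k))"

end

theory Submission
  imports Defs
begin

text \<open>
  A PDAO policy maximizes the reward pointwise, on every outcome, over all actions, so its reward
  dominates that of any competing policy at that time on every outcome. Monotonicity of the
  integral gives the GPS property once the rewards are known to be integrable; they are, because
  states and actions are measurable with values in finite sets.
\<close>

text \<open>Induction on the list. Since \<open>X\<close> is countable, the head may be frozen at a
  constant \<open>x\<close>, and prepending a fixed element is a map between discrete
  spaces.\<close>

lemma measurable_map_list:
  assumes "countable X" and "\<And>i. i \<in> set is \<Longrightarrow> f i \<in> M \<rightarrow>\<^sub>M count_space X"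
  shows "(\<lambda>\<omega>. map (\<lambda>i. f i \<omega>) is) \<in> M \<rightarrow>\<^sub>M count_space (lists X)"
  using assms(2)
proof (induction "is")
  case Nil
  then show ?case by simp
next
  case (Cons i "is")
  have tl: "(\<lambda>\<omega>. map (\<lambda>i. f i \<omega>) is) \<in> M \<rightarrow>\<^sub>M count_space (lists X)"
    using Cons by simp
  have "(\<lambda>\<omega>. x # map (\<lambda>i. f i \<omega>) is) \<in> M \<rightarrow>\<^sub>M count_space (lists X)" if "x \<in> X" for x
    by (rule measurable_compose[OF tl]) (use that in auto)
  then have "(\<lambda>\<omega>. f i \<omega> # map (\<lambda>i. f i \<omega>) is) \<in> M \<rightarrow>\<^sub>M count_space (lists X)"
    by (rule measurable_compose_countable'[OF _ Cons.prems assms(1)]) simp_all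
  then show ?case by simp
qed

text \<open>The history is pulled back along a measurable map of \<open>M\<close>, so it adds no new
  events. This lets policies, measurable with respect to the past noise, be integrated over
  \<open>M\<close>.\<close>

lemma subalgebra_noise_history:
  assumes "\<And>i. i \<in> {1..<k} \<Longrightarrow> \<xi> i \<in> M \<rightarrow>\<^sub>M S"
  shows "subalgebra M (noise_history M S \<xi> k)"
proof -
  have "(\<lambda>\<omega>. \<lambda>i\<in>{1..<k}. \<xi> i \<omega>) \<in> M \<rightarrow>\<^sub>M PiM {1..<k} (\<lambda>_. S)"
    using assms by (intro measurable_restrict) auto
  then have "sets (vimage_algebra (space M) (\<lambda>\<omega>. \<lambda>i\<in>{1..<k}. \<xi> i \<omega>) (PiM {1..<k} (\<lambda>_. S))) \<subseteq> sets M"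
    by (subst sets_vimage_algebra2) (auto dest: measurable_space measurable_sets)
  then show ?thesis
    by (simp add: subalgebra_def noise_history_def)
qed

lemma policy_at_measurable:
  assumes "\<And>i. i \<in> {1..<k} \<Longrightarrow> \<xi> i \<in> M \<rightarrow>\<^sub>M S" and "policy_at M S \<xi> X A k p" and "x \<in> X"
  shows "(\<lambda>\<omega>. p \<omega> x) \<in> M \<rightarrow>\<^sub>M count_space A"
proof (rule measurable_from_subalg)
  show "subalgebra M (noise_history M S \<xi> k)"
    using assms(1) by (rule subalgebra_noise_history)
  show "(\<lambda>\<omega>. p \<omega> x) \<in> noise_history M S \<xi> k \<rightarrow>\<^sub>M count_space A"
    using assms(2,3) by (simp add: policy_at_def)
qed

text \<open>The policy at each time is only known to be measurable for a fixed state, while here it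
  is evaluated at a random one. Countability of \<open>X\<close> and \<open>A\<close> bridges this:
  each step freezes first the state, then the action, leaving \<open>h x a\<close> applied to the
  noise.\<close>

lemma state_measurable:
  assumes "countable X" and "countable A" and "x1 \<in> X"
    and h: "\<And>x a. x \<in> X \<Longrightarrow> a \<in> A \<Longrightarrow> h x a \<in> S \<rightarrow>\<^sub>M count_space X"
    and "\<And>i. i \<in> {1..<k} \<Longrightarrow> \<xi> i \<in> M \<rightarrow>\<^sub>M S"
    and "\<And>i x. i \<in> {1..<k} \<Longrightarrow> x \<in> X \<Longrightarrow> (\<lambda>\<omega>. \<pi> i \<omega> x) \<in> M \<rightarrow>\<^sub>M count_space A"
  shows "state h \<xi> x1 \<pi> k \<in> M \<rightarrow>\<^sub>M count_space X"
  using assms(5,6)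
proof (induction k rule: induct_nat_012)
  case 0
  have "state h \<xi> x1 \<pi> 0 = (\<lambda>_. x1)" by auto
  then show ?case using \<open>x1 \<in> X\<close> by simp
next
  case 1
  have "state h \<xi> x1 \<pi> (Suc 0) = (\<lambda>_. x1)" by auto
  then show ?case using \<open>x1 \<in> X\<close> by simp
next
  case (ge2 n)
  let ?s = "state h \<xi> x1 \<pi> (Suc n)"
  have s: "?s \<in> M \<rightarrow>\<^sub>M count_space X"
    using ge2 by simp
  have noise: "\<xi> (Suc n) \<in> M \<rightarrow>\<^sub>M S"
    and act: "\<And>x. x \<in> X \<Longrightarrow> (\<lambda>\<omega>. \<pi> (Suc n) \<omega> x) \<in> M \<rightarrow>\<^sub>M count_space A"
    using ge2.prems by auto
  have "(\<lambda>\<omega>. h x (\<pi> (Suc n) \<omega> x) (\<xi> (Suc n) \<omega>)) \<in> M \<rightarrow>\<^sub>M count_space X" if "x \<in> X" for x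
    by (rule measurable_compose_countable'[OF measurable_compose[OF noise h] act])
      (use that \<open>countable A\<close> in auto)
  then have "(\<lambda>\<omega>. h (?s \<omega>) (\<pi> (Suc n) \<omega> (?s \<omega>)) (\<xi> (Suc n) \<omega>)) \<in> M \<rightarrow>\<^sub>M count_space X"
    by (rule measurable_compose_countable'[OF _ s \<open>countable X\<close>])
  \<comment> \<open>The recursion equation of \<open>state\<close> rewrites only once an outcome is
    supplied; \<open>measurable_cong\<close> supplies it.\<close>
  then show ?case
    by (simp only: state.simps(3) cong: measurable_cong)
qed

text \<open>The reward is measurable and takes finitely many values, hence is bounded. The last
  action \<open>b\<close> is kept separate from \<open>\<pi>\<close> so that it may come from a
  competing policy.\<close>

lemma path_reward_integrable:
  assumes "finite_measure M" and "finite X" and "finite A"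
    and s: "\<And>i. i \<in> {1..k} \<Longrightarrow> state h \<xi> x1 \<pi> i \<in> M \<rightarrow>\<^sub>M count_space X"
    and a: "\<And>i. i \<in> {1..<k} \<Longrightarrow>
      (\<lambda>\<omega>. \<pi> i \<omega> (state h \<xi> x1 \<pi> i \<omega>)) \<in> M \<rightarrow>\<^sub>M count_space A"
    and b: "b \<in> M \<rightarrow>\<^sub>M count_space A"
  shows "integrable M (\<lambda>\<omega>. path_reward g h \<xi> x1 \<pi> k \<omega> (b \<omega>))"
proof -
  interpret finite_measure M by fact
  let ?xs = "\<lambda>\<omega>. map (\<lambda>i. state h \<xi> x1 \<pi> i \<omega>) [1..<Suc k]"
  let ?as = "\<lambda>\<omega>. map (\<lambda>i. \<pi> i \<omega> (state h \<xi> x1 \<pi> i \<omega>)) [1..<k]"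
  have countable: "countable X" "countable A"
    using assms(2,3) by (auto intro: countable_finite)
  have xs: "?xs \<in> M \<rightarrow>\<^sub>M count_space (lists X)"
    by (rule measurable_map_list[OF countable(1)]) (use s in auto)
  have as: "?as \<in> M \<rightarrow>\<^sub>M count_space (lists A)"
    by (rule measurable_map_list[OF countable(2)]) (use a in auto)
  \<comment> \<open>No regularity of \<open>g\<close> is assumed: with both lists frozen, only the
    discrete variable \<open>b\<close> remains, and the lists are then restored one at a
    time.\<close>
  have "(\<lambda>\<omega>. g u (v @ [b \<omega>])) \<in> borel_measurable M" for u v
    by (rule measurable_compose[OF b]) simp
  then have "(\<lambda>\<omega>. g u (?as \<omega> @ [b \<omega>])) \<in> borel_measurable M" for u
    by (rule measurable_compose_countable'[OF _ as]) (use countable in auto)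
  then have meas: "(\<lambda>\<omega>. path_reward g h \<xi> x1 \<pi> k \<omega> (b \<omega>)) \<in> borel_measurable M"
    unfolding path_reward_def
    by (rule measurable_compose_countable'[OF _ xs]) (use countable in auto)
  \<comment> \<open>All arguments \<open>g\<close> can receive at time \<open>k\<close>; the action
    list has length \<open>k - 1\<close> because the last action is the third component.\<close>
  define L where "L = {u. set u \<subseteq> X \<and> length u = k} \<times> {v. set v \<subseteq> A \<and> length v = k - 1} \<times> A"
  define R where "R = (\<lambda>(u, v, c). norm (g u (v @ [c]))) ` L"
  have "finite R"
    using assms(2,3) by (simp add: R_def L_def finite_lists_length_eq)
  moreover have "norm (path_reward g h \<xi> x1 \<pi> k \<omega> (b \<omega>)) \<in> R" if "\<omega> \<in> space M" for \<omega>
  proof -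
    have "?xs \<omega> \<in> lists X" "?as \<omega> \<in> lists A" "b \<omega> \<in> A"
      using measurable_space[OF xs that] measurable_space[OF as that] measurable_space[OF b that]
      by simp_all
    then have "(?xs \<omega>, ?as \<omega>, b \<omega>) \<in> L"
      by (auto simp: L_def simp del: upt_Suc)
    then show ?thesis
      by (force simp: R_def path_reward_def simp del: upt_Suc)
  qed
  ultimately show ?thesis
    using meas by (intro integrable_const_bound[where B = "Max R"] AE_I2) auto
qed

theorem theorem2:
  fixes M :: "'w measure" and S :: "'s measure"
    and \<xi> :: "nat \<Rightarrow> 'w \<Rightarrow> 's"
    and X :: "'x set" and A :: "'a set"
    and K :: nat and x1 :: 'x
    and h :: "'x \<Rightarrow> 'a \<Rightarrow> 's \<Rightarrow> 'x"
    and g :: "'x list \<Rightarrow> 'a list \<Rightarrow> real"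
    and \<pi>p :: "nat \<Rightarrow> 'w \<Rightarrow> 'x \<Rightarrow> 'a"
  assumes "prob_space M"
    and "finite X" and "finite A"
    and "K \<ge> 1"
    and "x1 \<in> X"
    and indep: "prob_space.indep_vars M (\<lambda>_. S) \<xi> {1..<K}"
    and ident: "\<And>i j. i \<in> {1..<K} \<Longrightarrow> j \<in> {1..<K} \<Longrightarrow> distr M S (\<xi> i) = distr M S (\<xi> j)"
    and h: "\<And>x a. x \<in> X \<Longrightarrow> a \<in> A \<Longrightarrow> h x a \<in> S \<rightarrow>\<^sub>M count_space X"
    and g: "\<And>xs as. xs \<in> lists X \<Longrightarrow> xs \<noteq> [] \<Longrightarrow> as \<in> lists A \<Longrightarrow> as \<noteq> [] \<Longrightarrow> g xs as \<ge> 0"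
    and pdao: "pdao_scheme M S \<xi> X A K x1 h g \<pi>p"
  shows "\<exists>\<pi>g. gps_scheme M S \<xi> X A K x1 h g \<pi>g \<and> (\<forall>j\<in>{1..K}. \<pi>p j = \<pi>g j)"
proof (intro exI conjI)
  interpret prob_space M by fact
  have noise: "\<xi> i \<in> M \<rightarrow>\<^sub>M S" if "i \<in> {1..<K}" for i
    using indep that by (auto simp: indep_vars_def)
  have policy: "policy_at M S \<xi> X A k (\<pi>p k)" if "k \<in> {1..K}" for k
    using pdao that by (simp add: pdao_scheme_def)
  have countable: "countable X" "countable A"
    using \<open>finite X\<close> \<open>finite A\<close> by (auto intro: countable_finite)
  have policy_meas: "(\<lambda>\<omega>. p \<omega> x) \<in> M \<rightarrow>\<^sub>M count_space A"
    if "k \<in> {1..K}" "policy_at M S \<xi> X A k p" "x \<in> X" for k p x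
    by (rule policy_at_measurable[OF noise that(2,3)]) (use that in auto)
  have state_meas: "state h \<xi> x1 \<pi>p k \<in> M \<rightarrow>\<^sub>M count_space X" if "k \<in> {1..K}" for k
    by (rule state_measurable[OF countable \<open>x1 \<in> X\<close> h noise policy_meas[OF _ policy]])
      (use that in auto)
  \<comment> \<open>The competitor \<open>p\<close> is arbitrary, but it acts on the states
    generated by \<open>\<pi>p\<close>, as in the definition of a GPS scheme.\<close>
  have action_meas: "(\<lambda>\<omega>. p \<omega> (state h \<xi> x1 \<pi>p k \<omega>)) \<in> M \<rightarrow>\<^sub>M count_space A"
    if "k \<in> {1..K}" "policy_at M S \<xi> X A k p" for k p
    by (rule measurable_compose_countable'[OF policy_meas[OF that] state_meas[OF that(1)] countable(1)])
  have integrable: "integrable M (\<lambda>\<omega>. path_reward g h \<xi> x1 \<pi>p k \<omega> (p \<omega> (state h \<xi> x1 \<pi>p k \<omega>)))"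
    if "k \<in> {1..K}" "policy_at M S \<xi> X A k p" for k p
    by (rule path_reward_integrable[OF finite_measure_axioms \<open>finite X\<close> \<open>finite A\<close>
          state_meas action_meas[OF _ policy] action_meas[OF that]]) (use that in auto)
  have "(\<integral>\<omega>. path_reward g h \<xi> x1 \<pi>p k \<omega> (p \<omega> (state h \<xi> x1 \<pi>p k \<omega>)) \<partial>M)
      \<le> (\<integral>\<omega>. path_reward g h \<xi> x1 \<pi>p k \<omega> (\<pi>p k \<omega> (state h \<xi> x1 \<pi>p k \<omega>)) \<partial>M)"
    if k: "k \<in> {1..K}" and p: "policy_at M S \<xi> X A k p" for k p
  proof (rule integral_mono[OF integrable[OF k p] integrable[OF k policy[OF k]]])
    \<comment> \<open>Membership in \<open>A\<close> is what makes the competing action admissible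
      in the pointwise maximization; it is contained in measurability into
      \<open>count_space A\<close>.\<close>
    fix \<omega> assume "\<omega> \<in> space M"
    moreover from this have "p \<omega> (state h \<xi> x1 \<pi>p k \<omega>) \<in> A"
      using measurable_space[OF action_meas[OF k p]] by simp
    ultimately show "path_reward g h \<xi> x1 \<pi>p k \<omega> (p \<omega> (state h \<xi> x1 \<pi>p k \<omega>))
        \<le> path_reward g h \<xi> x1 \<pi>p k \<omega> (\<pi>p k \<omega> (state h \<xi> x1 \<pi>p k \<omega>))"
      using pdao k by (auto simp: pdao_scheme_def is_arg_max_def not_less)
  qed
  \<comment> \<open>The witness is \<open>\<pi>p\<close> itself, so the required agreement at all
    times is reflexivity.\<close>
  then show "gps_scheme M S \<xi> X A K x1 h g \<pi>p"
    using policy by (auto simp: gps_scheme_def is_arg_max_def not_less)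
qed simp

end
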